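(* Let $x_1$ and $x_2$ be uncorrelated real-valued random variables with means $\mu_1,\mu_2$ and finite variances $\sigma_1^2,\sigma_2^2$ respectively, where $\sigma_1^2+\sigma_2^2>0$. For $\alpha\in\mathbb{R}$ consider the linear estimator $y_\alpha(x_1,x_2)=(1-\alpha)x_1+\alpha x_2$. Then the variance of $y_\alpha(x_1,x_2)$, as a function of $\alpha\in\mathbb{R}$, is minimized at $$\alpha=\frac{\sigma_1^2}{\sigma_1^2+\sigma_2^2}.$$
   Context: Two random variables are uncorrelated if their covariance $E[(x_1-\mu_1)(x_2-\mu_2)]$ is zero. The means $\mu_1,\mu_2$ are not assumed equal, and no assumption is made on the form of the distributions. *)

theory Defs
  imports "HOL-Probability.Probability"
begin

text \<open>
  Covariance and uncorrelatedness are meant for square-integrable random variables only: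
  the Bochner integral of a non-integrable function is 0, so the expectations
  below carry information only together with integrability assumptions.
\<close>

definition covariance :: "'a measure \<Rightarrow> ('a \<Rightarrow> real) \<Rightarrow> ('a \<Rightarrow> real) \<Rightarrow> real" where
  "covariance M X Y =
     prob_space.expectation M
       (\<lambda>\<omega>. (X \<omega> - prob_space.expectation M X) * (Y \<omega> - prob_space.expectation M Y))"

definition uncorrelated :: "'a measure \<Rightarrow> ('a \<Rightarrow> real) \<Rightarrow> ('a \<Rightarrow> real) \<Rightarrow> bool" where
  "uncorrelated M X Y \<longleftrightarrow> covariance M X Y = 0"

definition linear_estimator :: "real \<Rightarrow> real \<Rightarrow> real \<Rightarrow> real" where
  "linear_estimator \<alpha> x1 x2 = (1 - \<alpha>) * x1 + \<alpha> * x2"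

end

theory Submission
  imports Defs
begin

text \<open>Centering both variables and expanding the square, the cross term of the estimator's
  variance is a multiple of the covariance, hence zero. So the variance is \<open>(1 -
  \<alpha>)\<^sup>2 * \<sigma>1\<^sup>2 + \<alpha>\<^sup>2 * \<sigma>2\<^sup>2\<close>
  (\<open>variance_linear_estimator\<close>), a quadratic in \<alpha> with leading coefficient
  \<open>\<sigma>1\<^sup>2 + \<sigma>2\<^sup>2 > 0\<close>. Completing the square
  (\<open>weighted_squares_minimum\<close>) locates its vertex.
  \<open>integrable_mult_of_squares\<close> justifies splitting the expectation termwise.\<close>

lemma integrable_mult_of_squares:
  fixes f g :: "'a \<Rightarrow> real"
  assumes [measurable]: "f \<in> borel_measurable M" "g \<in> borel_measurable M"
    and "integrable M (\<lambda>x. (f x)\<^sup>2)" "integrable M (\<lambda>x. (g x)\<^sup>2)"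
  shows "integrable M (\<lambda>x. f x * g x)"
proof (rule Bochner_Integration.integrable_bound)
  show "integrable M (\<lambda>x. (f x)\<^sup>2 + (g x)\<^sup>2)"
    using assms(3,4) by simp
  \<comment> \<open>The dominating function comes from
    \<open>(\<bar>a\<bar> - \<bar>b\<bar>)\<^sup>2 \<ge> 0\<close>; the spare factor 2 is
    dropped.\<close>
  have "\<bar>a * b\<bar> \<le> a\<^sup>2 + b\<^sup>2" for a b :: real
  proof -
    have "2 * (\<bar>a\<bar> * \<bar>b\<bar>) \<le> a\<^sup>2 + b\<^sup>2"
      using sum_squares_bound[of "\<bar>a\<bar>" "\<bar>b\<bar>"] by (simp add: mult.assoc)
    moreover have "0 \<le> \<bar>a\<bar> * \<bar>b\<bar>"
      by simp
    ultimately show ?thesis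
      unfolding abs_mult by linarith
  qed
  then show "AE x in M. norm (f x * g x) \<le> norm ((f x)\<^sup>2 + (g x)\<^sup>2)"
    by simp
qed simp

lemma (in prob_space) variance_linear_estimator:
  fixes X Y :: "'a \<Rightarrow> real"
  assumes [simp]: "integrable M X" "integrable M Y"
    and sq [simp]: "integrable M (\<lambda>\<omega>. (X \<omega> - expectation X)\<^sup>2)"
      "integrable M (\<lambda>\<omega>. (Y \<omega> - expectation Y)\<^sup>2)"
    and "uncorrelated M X Y"
  shows "variance (\<lambda>\<omega>. linear_estimator \<alpha> (X \<omega>) (Y \<omega>)) =
    (1 - \<alpha>)\<^sup>2 * variance X + \<alpha>\<^sup>2 * variance Y"
proof -
  define U where "U \<omega> = X \<omega> - expectation X" for \<omega>
  define V where "V \<omega> = Y \<omega> - expectation Y" for \<omega>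
  have [simp]: "integrable M (\<lambda>\<omega>. (U \<omega>)\<^sup>2)" "integrable M (\<lambda>\<omega>. (V \<omega>)\<^sup>2)"
    using sq by (simp_all add: U_def V_def)
  have "integrable M U" "integrable M V"
    by (simp_all add: U_def [abs_def] V_def [abs_def])
  \<comment> \<open>Linearity of the integral below needs the cross term to be integrable;
    \<open>cov\<close> alone does not give this, since a non-integrable product would also have
    integral 0. Integrability of \<open>U\<close> and \<open>V\<close> enters here through their
    measurability.\<close>
  then have [simp]: "integrable M (\<lambda>\<omega>. U \<omega> * V \<omega>)"
    by (intro integrable_mult_of_squares) auto
  have cov: "expectation (\<lambda>\<omega>. U \<omega> * V \<omega>) = 0"
    using assms(5) by (simp add: uncorrelated_def covariance_def U_def V_def)
  \<comment> \<open>The estimator has mean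
    \<open>(1 - \<alpha>) * expectation X + \<alpha> * expectation Y\<close>, so each variable is
    centered at its own mean, whether or not the two means agree.\<close>
  have "linear_estimator \<alpha> (X \<omega>) (Y \<omega>) -
      expectation (\<lambda>\<omega>. linear_estimator \<alpha> (X \<omega>) (Y \<omega>)) = (1 - \<alpha>) * U \<omega> + \<alpha> * V \<omega>" for \<omega>
    by (simp add: linear_estimator_def U_def V_def algebra_simps)
  then have "variance (\<lambda>\<omega>. linear_estimator \<alpha> (X \<omega>) (Y \<omega>)) =
      expectation (\<lambda>\<omega>. (1 - \<alpha>)\<^sup>2 * (U \<omega>)\<^sup>2 + \<alpha>\<^sup>2 * (V \<omega>)\<^sup>2 +
        2 * (1 - \<alpha>) * \<alpha> * (U \<omega> * V \<omega>))"
    by (simp add: power2_sum power_mult_distrib mult_ac)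
  also have "\<dots> = (1 - \<alpha>)\<^sup>2 * expectation (\<lambda>\<omega>. (U \<omega>)\<^sup>2) + \<alpha>\<^sup>2 * expectation (\<lambda>\<omega>. (V \<omega>)\<^sup>2)"
    using cov by simp
  finally show ?thesis
    by (simp add: U_def V_def)
qed

text \<open>The quadratic has its vertex at \<open>t\<close>, and its excess over the value there is
  exactly \<open>(a + b) * (\<alpha> - t)\<^sup>2\<close>.\<close>

lemma weighted_squares_minimum:
  fixes a b \<alpha> :: real
  assumes "a + b > 0"
  defines "t \<equiv> a / (a + b)"
  shows "(1 - t)\<^sup>2 * a + t\<^sup>2 * b \<le> (1 - \<alpha>)\<^sup>2 * a + \<alpha>\<^sup>2 * b"
proof -
  \<comment> \<open>Clearing the denominator turns the next identity into a polynomial consequence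
    of this equation, within reach of \<open>algebra\<close>.\<close>
  have "a = t * (a + b)"
    using assms(1) by (simp add: t_def)
  then have "(1 - \<alpha>)\<^sup>2 * a + \<alpha>\<^sup>2 * b - ((1 - t)\<^sup>2 * a + t\<^sup>2 * b) = (a + b) * (\<alpha> - t)\<^sup>2"
    by algebra
  moreover have "0 \<le> (a + b) * (\<alpha> - t)\<^sup>2"
    using assms(1) by simp
  ultimately show ?thesis
    by linarith
qed

theorem theorem3p1:
  fixes M :: "'a measure"
    and x1 x2 :: "'a \<Rightarrow> real"
    and \<mu>1 \<mu>2 \<sigma>1 \<sigma>2 :: real
  assumes "prob_space M"
    and "integrable M x1" and "prob_space.expectation M x1 = \<mu>1"
    and "integrable M x2" and "prob_space.expectation M x2 = \<mu>2"
    and "integrable M (\<lambda>\<omega>. (x1 \<omega> - \<mu>1)\<^sup>2)" and "prob_space.variance M x1 = \<sigma>1\<^sup>2"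
    and "integrable M (\<lambda>\<omega>. (x2 \<omega> - \<mu>2)\<^sup>2)" and "prob_space.variance M x2 = \<sigma>2\<^sup>2"
    and "uncorrelated M x1 x2"
    and "\<sigma>1\<^sup>2 + \<sigma>2\<^sup>2 > 0"
  shows "is_arg_min
           (\<lambda>\<alpha>::real. prob_space.variance M (\<lambda>\<omega>. linear_estimator \<alpha> (x1 \<omega>) (x2 \<omega>)))
           (\<lambda>\<alpha>. True)
           (\<sigma>1\<^sup>2 / (\<sigma>1\<^sup>2 + \<sigma>2\<^sup>2))"
proof -
  interpret prob_space M by fact
  have "variance (\<lambda>\<omega>. linear_estimator \<alpha> (x1 \<omega>) (x2 \<omega>)) =
      (1 - \<alpha>)\<^sup>2 * \<sigma>1\<^sup>2 + \<alpha>\<^sup>2 * \<sigma>2\<^sup>2" for \<alpha>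
    using variance_linear_estimator[of x1 x2 \<alpha>] assms by simp
  \<comment> \<open>\<open>is_arg_min\<close> says that no value is strictly smaller; over the
    linearly ordered reals this is the inequality just proved for every \<alpha>.\<close>
  then show ?thesis
    using weighted_squares_minimum[OF \<open>\<sigma>1\<^sup>2 + \<sigma>2\<^sup>2 > 0\<close>]
    by (simp add: is_arg_min_linorder)
qed

end
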